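(* Let $\Gamma$ be a groupoid and let $R$ be a $d$-finitely generated $\Gamma$-graded ring. If $R$ is right $\Gamma_0$-artinian, then $\mathrm{rad}^{\mathrm{gr}}(R)$ is nilpotent and $R$ is a right $\Gamma_0$-noetherian ring.
   Context: A groupoid $\Gamma$ is the set of morphisms of a small category in which all morphisms are invertible; $\Gamma_0\subseteq\Gamma$ is the set of identity morphisms; $d(\gamma)=\gamma^{-1}\gamma$, $r(\gamma)=\gamma\gamma^{-1}$; the product $\gamma\delta$ is defined iff $d(\gamma)=r(\delta)$. Rings are associative, not necessarily unital. A $\Gamma$-graded ring is a ring $R=\bigoplus_{\gamma\in\Gamma}R_\gamma$ (additive subgroups) with $R_\gamma R_\delta\subseteq R_{\gamma\delta}$ if $d(\gamma)=r(\delta)$ and $R_\gamma R_\delta=0$ otherwise; it is always assumed object unital: for each $e\in\Gamma_0$ the ring $R_e$ has an identity $1_e$ (possibly $0$) with $1_{r(\gamma)}a=a=a1_{d(\gamma)}$ for all $a\in R_\gamma$, $\gamma\in\Gamma$. One- or two-sided ideals $U$ are graded if $U=\bigoplus_\gamma (U\cap R_\gamma)$. $R$ is $d$-finitely generated if there is a finite set $\Delta_0\subseteq\Gamma_0$ with $R=\sum_{e\in\Delta_0}R1_eR$. $R$ is right $\Gamma_0$-artinian (resp. right $\Gamma_0$-noetherian) if for every $e\in\Gamma_0$ there is no infinite strictly decreasing (resp. increasing) chain of graded right ideals of $R$ contained in $1_eR$. $\mathrm{rad}^{\mathrm{gr}}(R)$ is the intersection of all gr-maximal graded right ideals (those maximal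 among proper graded right ideals); it is a graded two-sided ideal. An ideal $U$ is nilpotent if $U^n=0$ for some positive integer $n$. *)

theory Defs
  imports Main "HOL.Hull"
begin

text \<open>A groupoid is given by its set of arrows, with objects identified with identity arrows.
  The operation \<open>gmul\<close> is total; its value \<open>\<gamma>\<delta>\<close> is meaningful only if \<open>d(\<gamma>) = r(\<delta>)\<close>.\<close>

record 'g groupoid_data =
  arrows :: "'g set"
  gdom :: "'g \<Rightarrow> 'g"
  gcod :: "'g \<Rightarrow> 'g"
  gmul :: "'g \<Rightarrow> 'g \<Rightarrow> 'g"
  ginv :: "'g \<Rightarrow> 'g"

locale groupoid =
  fixes \<Gamma> :: "'g groupoid_data"
  assumes dom_closed: "\<gamma> \<in> arrows \<Gamma> \<Longrightarrow> gdom \<Gamma> \<gamma> \<in> arrows \<Gamma>"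
    and cod_closed: "\<gamma> \<in> arrows \<Gamma> \<Longrightarrow> gcod \<Gamma> \<gamma> \<in> arrows \<Gamma>"
    and dom_dom: "\<gamma> \<in> arrows \<Gamma> \<Longrightarrow> gdom \<Gamma> (gdom \<Gamma> \<gamma>) = gdom \<Gamma> \<gamma>"
    and cod_dom: "\<gamma> \<in> arrows \<Gamma> \<Longrightarrow> gcod \<Gamma> (gdom \<Gamma> \<gamma>) = gdom \<Gamma> \<gamma>"
    and dom_cod: "\<gamma> \<in> arrows \<Gamma> \<Longrightarrow> gdom \<Gamma> (gcod \<Gamma> \<gamma>) = gcod \<Gamma> \<gamma>"
    and cod_cod: "\<gamma> \<in> arrows \<Gamma> \<Longrightarrow> gcod \<Gamma> (gcod \<Gamma> \<gamma>) = gcod \<Gamma> \<gamma>"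
    and mul_closed: "\<lbrakk>\<gamma> \<in> arrows \<Gamma>; \<delta> \<in> arrows \<Gamma>; gdom \<Gamma> \<gamma> = gcod \<Gamma> \<delta>\<rbrakk>
          \<Longrightarrow> gmul \<Gamma> \<gamma> \<delta> \<in> arrows \<Gamma>"
    and dom_mul: "\<lbrakk>\<gamma> \<in> arrows \<Gamma>; \<delta> \<in> arrows \<Gamma>; gdom \<Gamma> \<gamma> = gcod \<Gamma> \<delta>\<rbrakk>
          \<Longrightarrow> gdom \<Gamma> (gmul \<Gamma> \<gamma> \<delta>) = gdom \<Gamma> \<delta>"
    and cod_mul: "\<lbrakk>\<gamma> \<in> arrows \<Gamma>; \<delta> \<in> arrows \<Gamma>; gdom \<Gamma> \<gamma> = gcod \<Gamma> \<delta>\<rbrakk>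
          \<Longrightarrow> gcod \<Gamma> (gmul \<Gamma> \<gamma> \<delta>) = gcod \<Gamma> \<gamma>"
    and mul_assoc: "\<lbrakk>\<gamma> \<in> arrows \<Gamma>; \<delta> \<in> arrows \<Gamma>; \<eta> \<in> arrows \<Gamma>;
           gdom \<Gamma> \<gamma> = gcod \<Gamma> \<delta>; gdom \<Gamma> \<delta> = gcod \<Gamma> \<eta>\<rbrakk>
          \<Longrightarrow> gmul \<Gamma> (gmul \<Gamma> \<gamma> \<delta>) \<eta> = gmul \<Gamma> \<gamma> (gmul \<Gamma> \<delta> \<eta>)"
    and mul_dom: "\<gamma> \<in> arrows \<Gamma> \<Longrightarrow> gmul \<Gamma> \<gamma> (gdom \<Gamma> \<gamma>) = \<gamma>"
    and cod_mul_self: "\<gamma> \<in> arrows \<Gamma> \<Longrightarrow> gmul \<Gamma> (gcod \<Gamma> \<gamma>) \<gamma> = \<gamma>"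
    and inv_closed: "\<gamma> \<in> arrows \<Gamma> \<Longrightarrow> ginv \<Gamma> \<gamma> \<in> arrows \<Gamma>"
    and dom_inv: "\<gamma> \<in> arrows \<Gamma> \<Longrightarrow> gdom \<Gamma> (ginv \<Gamma> \<gamma>) = gcod \<Gamma> \<gamma>"
    and cod_inv: "\<gamma> \<in> arrows \<Gamma> \<Longrightarrow> gcod \<Gamma> (ginv \<Gamma> \<gamma>) = gdom \<Gamma> \<gamma>"
    and dom_eq: "\<gamma> \<in> arrows \<Gamma> \<Longrightarrow> gdom \<Gamma> \<gamma> = gmul \<Gamma> (ginv \<Gamma> \<gamma>) \<gamma>"
    and cod_eq: "\<gamma> \<in> arrows \<Gamma> \<Longrightarrow> gcod \<Gamma> \<gamma> = gmul \<Gamma> \<gamma> (ginv \<Gamma> \<gamma>)"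

definition identities :: "'g groupoid_data \<Rightarrow> 'g set"
  where "identities \<Gamma> = gdom \<Gamma> ` arrows \<Gamma>"

text \<open>Rings are elements of the type class \<open>ring\<close>, which does not require an identity.\<close>

definition add_subgroup :: "'r::ab_group_add set \<Rightarrow> bool"
  where "add_subgroup A \<longleftrightarrow> 0 \<in> A \<and> (\<forall>x\<in>A. \<forall>y\<in>A. x + y \<in> A) \<and> (\<forall>x\<in>A. - x \<in> A)"

definition fin_supp_families :: "'i set \<Rightarrow> ('i \<Rightarrow> 'r::ab_group_add set) \<Rightarrow> ('i \<Rightarrow> 'r) set"
  where "fin_supp_families I A =
    {f. (\<forall>i\<in>I. f i \<in> A i) \<and> (\<forall>i. i \<notin> I \<longrightarrow> f i = 0) \<and> finite {i. f i \<noteq> 0}}"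

text \<open>\<open>U\<close> is the internal direct sum of the additive subgroups \<open>A i\<close> (\<open>i \<in> I\<close>): the sums of
  finitely supported families are exactly the elements of \<open>U\<close>, each arising only once.\<close>

definition internal_direct_sum ::
    "'r::ab_group_add set \<Rightarrow> 'i set \<Rightarrow> ('i \<Rightarrow> 'r set) \<Rightarrow> bool"
  where "internal_direct_sum U I A \<longleftrightarrow>
    (\<forall>i\<in>I. add_subgroup (A i)) \<and>
    bij_betw (\<lambda>f. \<Sum>i | f i \<noteq> 0. f i) (fin_supp_families I A) U"

text \<open>The family \<open>one\<close> of local identities is uniquely determined on \<open>identities \<Gamma>\<close> by the last
  three assumptions, which for arrows in \<open>identities \<Gamma>\<close> say that \<open>one e\<close> is the identity of the
  ring \<open>R e\<close>.\<close>

locale graded_ring = groupoid \<Gamma>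
  for \<Gamma> :: "'g groupoid_data" +
  fixes R :: "'g \<Rightarrow> 'r::ring set"
    and one :: "'g \<Rightarrow> 'r"
  assumes direct_sum: "internal_direct_sum UNIV (arrows \<Gamma>) R"
    and mult_composable: "\<lbrakk>\<gamma> \<in> arrows \<Gamma>; \<delta> \<in> arrows \<Gamma>; gdom \<Gamma> \<gamma> = gcod \<Gamma> \<delta>; a \<in> R \<gamma>; b \<in> R \<delta>\<rbrakk>
          \<Longrightarrow> a * b \<in> R (gmul \<Gamma> \<gamma> \<delta>)"
    and mult_not_composable:
          "\<lbrakk>\<gamma> \<in> arrows \<Gamma>; \<delta> \<in> arrows \<Gamma>; gdom \<Gamma> \<gamma> \<noteq> gcod \<Gamma> \<delta>; a \<in> R \<gamma>; b \<in> R \<delta>\<rbrakk>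
          \<Longrightarrow> a * b = 0"
    and one_closed: "e \<in> identities \<Gamma> \<Longrightarrow> one e \<in> R e"
    and one_left: "\<lbrakk>\<gamma> \<in> arrows \<Gamma>; a \<in> R \<gamma>\<rbrakk> \<Longrightarrow> one (gcod \<Gamma> \<gamma>) * a = a"
    and one_right: "\<lbrakk>\<gamma> \<in> arrows \<Gamma>; a \<in> R \<gamma>\<rbrakk> \<Longrightarrow> a * one (gdom \<Gamma> \<gamma>) = a"

definition right_ideal :: "'r::ring set \<Rightarrow> bool"
  where "right_ideal U \<longleftrightarrow> add_subgroup U \<and> (\<forall>u\<in>U. \<forall>x. u * x \<in> U)"

definition graded_right_ideal :: "'g groupoid_data \<Rightarrow> ('g \<Rightarrow> 'r::ring set) \<Rightarrow> 'r set \<Rightarrow> bool"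
  where "graded_right_ideal \<Gamma> R U \<longleftrightarrow>
    right_ideal U \<and> internal_direct_sum U (arrows \<Gamma>) (\<lambda>\<gamma>. U \<inter> R \<gamma>)"

definition gr_maximal_right_ideal :: "'g groupoid_data \<Rightarrow> ('g \<Rightarrow> 'r::ring set) \<Rightarrow> 'r set \<Rightarrow> bool"
  where "gr_maximal_right_ideal \<Gamma> R M \<longleftrightarrow>
    graded_right_ideal \<Gamma> R M \<and> M \<noteq> UNIV \<and>
    (\<forall>V. graded_right_ideal \<Gamma> R V \<and> V \<noteq> UNIV \<and> M \<subseteq> V \<longrightarrow> V = M)"

definition gr_radical :: "'g groupoid_data \<Rightarrow> ('g \<Rightarrow> 'r::ring set) \<Rightarrow> 'r set"
  where "gr_radical \<Gamma> R = \<Inter>{M. gr_maximal_right_ideal \<Gamma> R M}"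

text \<open>Products of additive subgroups and ideals, such as \<open>R 1\<^sub>e R\<close>, consist of finite sums
  of products of elements.\<close>

definition ideal_prod :: "'r::ring set \<Rightarrow> 'r set \<Rightarrow> 'r set"
  where "ideal_prod I J = add_subgroup hull {a * b | a b. a \<in> I \<and> b \<in> J}"

text \<open>The value at exponent 0 is a mere convention and is not used by \<open>nilpotent_ideal\<close>.\<close>

fun ideal_power :: "'r::ring set \<Rightarrow> nat \<Rightarrow> 'r set"
  where
    "ideal_power U 0 = UNIV"
  | "ideal_power U (Suc 0) = U"
  | "ideal_power U (Suc (Suc n)) = ideal_prod (ideal_power U (Suc n)) U"

definition nilpotent_ideal :: "'r::ring set \<Rightarrow> bool"
  where "nilpotent_ideal U \<longleftrightarrow> (\<exists>n>0. ideal_power U n = {0})"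

definition d_finitely_generated :: "'g groupoid_data \<Rightarrow> ('g \<Rightarrow> 'r::ring) \<Rightarrow> bool"
  where "d_finitely_generated \<Gamma> one \<longleftrightarrow>
    (\<exists>\<Delta>\<^sub>0. finite \<Delta>\<^sub>0 \<and> \<Delta>\<^sub>0 \<subseteq> identities \<Gamma> \<and>
      (UNIV :: 'r set) =
        {\<Sum>e\<in>\<Delta>\<^sub>0. f e | f. \<forall>e\<in>\<Delta>\<^sub>0. f e \<in> add_subgroup hull {a * one e * b | a b. True}})"

definition right_artinian_at_objects ::
    "'g groupoid_data \<Rightarrow> ('g \<Rightarrow> 'r::ring set) \<Rightarrow> ('g \<Rightarrow> 'r) \<Rightarrow> bool"
  where "right_artinian_at_objects \<Gamma> R one \<longleftrightarrow>
    (\<forall>e\<in>identities \<Gamma>. \<not> (\<exists>U :: nat \<Rightarrow> 'r set. \<forall>n.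
      graded_right_ideal \<Gamma> R (U n) \<and> U n \<subseteq> {one e * x | x. True} \<and> U (Suc n) \<subset> U n))"

definition right_noetherian_at_objects ::
    "'g groupoid_data \<Rightarrow> ('g \<Rightarrow> 'r::ring set) \<Rightarrow> ('g \<Rightarrow> 'r) \<Rightarrow> bool"
  where "right_noetherian_at_objects \<Gamma> R one \<longleftrightarrow>
    (\<forall>e\<in>identities \<Gamma>. \<not> (\<exists>U :: nat \<Rightarrow> 'r set. \<forall>n.
      graded_right_ideal \<Gamma> R (U n) \<and> U n \<subseteq> {one e * x | x. True} \<and> U n \<subset> U (Suc n)))"

end

theory Submission
  imports Defs "HOL-Library.Set_Algebras"
begin

text \<open>
  Let \<open>J\<close> be the graded radical. Finitely many objects generate \<open>R\<close>, so the descending chains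
  \<open>1\<^sub>e J\<^sup>n\<close> at these objects stabilise simultaneously, and some power \<open>I = J\<^sup>n\<close> is idempotent. If
  \<open>I \<noteq> 0\<close>, a minimal graded right ideal \<open>K \<subseteq> 1\<^sub>e R\<close> with \<open>K I \<noteq> 0\<close> has the form \<open>x I\<close> with
  \<open>x \<in> K\<close> homogeneous, so that \<open>x = x y\<close> with \<open>y \<in> J\<close>, which forces \<open>x = 0\<close>.

  For the noetherian property, every graded right ideal in \<open>1\<^sub>e R\<close> has a supplement that it
  meets inside \<open>J\<close>, a minimal one by the artinian condition. This makes each factor
  \<open>1\<^sub>e J\<^sup>k / 1\<^sub>e J\<^sup>k\<^sup>+\<^sup>1\<close> semisimple, so the ascending chain condition in it follows from the
  descending one by passing to complements, and there are finitely many such factors.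
\<close>

section \<open>Products of ideals\<close>

lemma add_subgroup_0: "add_subgroup A \<Longrightarrow> 0 \<in> A"
  and add_subgroup_add: "add_subgroup A \<Longrightarrow> x \<in> A \<Longrightarrow> y \<in> A \<Longrightarrow> x + y \<in> A"
  and add_subgroup_uminus: "add_subgroup A \<Longrightarrow> x \<in> A \<Longrightarrow> - x \<in> A"
  by (auto simp: add_subgroup_def)

lemma add_subgroup_diff: "add_subgroup A \<Longrightarrow> x \<in> A \<Longrightarrow> y \<in> A \<Longrightarrow> x - y \<in> A"
  using add_subgroup_add[of A x "- y"] add_subgroup_uminus[of A y] by simp

lemma add_subgroup_sum:
  assumes "add_subgroup A" "\<And>i. i \<in> I \<Longrightarrow> f i \<in> A"
  shows "sum f I \<in> A"
  using assms(2)
  by (induction I rule: infinite_finite_induct)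
     (auto intro: add_subgroup_0 add_subgroup_add assms(1))

lemma add_subgroup_Int: "add_subgroup A \<Longrightarrow> add_subgroup B \<Longrightarrow> add_subgroup (A \<inter> B)"
  by (auto simp: add_subgroup_def)

lemma add_subgroup_hull: "add_subgroup (add_subgroup hull S)"
  by (rule hull_in) (auto simp: add_subgroup_def)

lemma add_subgroup_vimage_mult_left:
  fixes a :: "'r::ring"
  shows "add_subgroup A \<Longrightarrow> add_subgroup {x. a * x \<in> A}"
  by (auto simp: add_subgroup_def distrib_left)

lemma add_subgroup_vimage_mult_right:
  fixes a :: "'r::ring"
  shows "add_subgroup A \<Longrightarrow> add_subgroup {x. x * a \<in> A}"
  by (auto simp: add_subgroup_def distrib_right)

lemma add_subgroup_plus:
  assumes A: "add_subgroup A" and B: "add_subgroup B"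
  shows "add_subgroup (A + B)"
  unfolding add_subgroup_def
proof (intro conjI ballI)
  show "0 \<in> A + B"
    using set_plus_intro[OF add_subgroup_0[OF A] add_subgroup_0[OF B]] by simp
next
  fix x y assume "x \<in> A + B" "y \<in> A + B"
  then obtain a b c d where "a \<in> A" "b \<in> B" "x = a + b" "c \<in> A" "d \<in> B" "y = c + d"
    by (auto elim!: set_plus_elim)
  moreover then have "x + y = (a + c) + (b + d)" by (simp add: algebra_simps)
  ultimately show "x + y \<in> A + B"
    using set_plus_intro[OF add_subgroup_add[OF A] add_subgroup_add[OF B]] by metis
next
  fix x assume "x \<in> A + B"
  then obtain a b where "a \<in> A" "b \<in> B" "x = a + b" by (auto elim!: set_plus_elim)
  moreover then have "- x = - a + - b" by simp
  ultimately show "- x \<in> A + B"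
    using set_plus_intro[OF add_subgroup_uminus[OF A] add_subgroup_uminus[OF B]] by metis
qed

lemma ideal_prod_subgroup: "add_subgroup (ideal_prod I J)"
  unfolding ideal_prod_def by (rule add_subgroup_hull)

lemma ideal_prodI: "a \<in> I \<Longrightarrow> b \<in> J \<Longrightarrow> a * b \<in> ideal_prod I J"
  unfolding ideal_prod_def by (rule hull_inc) auto

lemma ideal_prod_subset:
  assumes "add_subgroup S" "\<And>a b. a \<in> I \<Longrightarrow> b \<in> J \<Longrightarrow> a * b \<in> S"
  shows "ideal_prod I J \<subseteq> S"
  unfolding ideal_prod_def by (rule hull_minimal) (use assms in auto)

text \<open>For fixed \<open>c\<close>, the elements \<open>x\<close> with \<open>x * c\<close> in
  the target form an additive subgroup containing the generators \<open>a * b\<close>, hence the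
  whole hull. This device, a preimage subgroup tested on generators, recurs below.\<close>

lemma ideal_prod_assoc_subset: "ideal_prod (ideal_prod I J) K \<subseteq> ideal_prod I (ideal_prod J K)"
proof (rule ideal_prod_subset[OF ideal_prod_subgroup])
  fix x c assume x: "x \<in> ideal_prod I J" and c: "c \<in> K"
  have "ideal_prod I J \<subseteq> {x. x * c \<in> ideal_prod I (ideal_prod J K)}"
    by (rule ideal_prod_subset)
       (auto intro!: add_subgroup_vimage_mult_right ideal_prod_subgroup ideal_prodI c simp: mult.assoc)
  with x show "x * c \<in> ideal_prod I (ideal_prod J K)" by blast
qed

lemma ideal_prod_mono: "I \<subseteq> I' \<Longrightarrow> J \<subseteq> J' \<Longrightarrow> ideal_prod I J \<subseteq> ideal_prod I' J'"
  by (rule ideal_prod_subset[OF ideal_prod_subgroup]) (auto intro: ideal_prodI)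

lemma ideal_power_Suc: "n > 0 \<Longrightarrow> ideal_power J (Suc n) = ideal_prod (ideal_power J n) J"
  by (cases n) auto

text \<open>Powers grow by a factor on the right, so associativity moves the last factor into the
  second power. Exponent 0 stands for the whole ring and is excluded: without an identity,
  \<open>J\<close> need not lie in the product of the ring with \<open>J\<close>.\<close>

lemma ideal_power_add_subset:
  assumes "n > 0" "m > 0"
  shows "ideal_power J (n + m) \<subseteq> ideal_prod (ideal_power J n) (ideal_power J m)"
  using assms(2)
proof (induction m rule: nat_induct_non_zero)
  case 1
  then show ?case using assms(1) by (simp add: ideal_power_Suc)
next
  case (Suc m)
  have "ideal_power J (n + Suc m) = ideal_prod (ideal_power J (n + m)) J"
    using assms(1) by (simp add: ideal_power_Suc)
  also have "\<dots> \<subseteq> ideal_prod (ideal_prod (ideal_power J n) (ideal_power J m)) J"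
    by (rule ideal_prod_mono[OF Suc.IH]) simp
  also have "\<dots> \<subseteq> ideal_prod (ideal_power J n) (ideal_prod (ideal_power J m) J)"
    by (rule ideal_prod_assoc_subset)
  finally show ?case using Suc.hyps by (simp add: ideal_power_Suc)
qed

section \<open>One-sided ideals and their powers\<close>

definition left_ideal :: "'r::ring set \<Rightarrow> bool"
  where "left_ideal U \<longleftrightarrow> add_subgroup U \<and> (\<forall>u\<in>U. \<forall>x. x * u \<in> U)"

lemma left_ideal_ideal_prod:
  assumes "left_ideal I"
  shows "left_ideal (ideal_prod I J)"
  unfolding left_ideal_def
proof (intro conjI ballI allI ideal_prod_subgroup)
  fix u x assume u: "u \<in> ideal_prod I J"
  have "ideal_prod I J \<subseteq> {u. x * u \<in> ideal_prod I J}"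
    by (rule ideal_prod_subset)
       (use assms in \<open>auto intro!: add_subgroup_vimage_mult_left ideal_prod_subgroup ideal_prodI
         simp: left_ideal_def mult.assoc[symmetric]\<close>)
  with u show "x * u \<in> ideal_prod I J" by blast
qed

lemma right_ideal_ideal_prod:
  assumes "right_ideal J"
  shows "right_ideal (ideal_prod I J)"
  unfolding right_ideal_def
proof (intro conjI ballI allI ideal_prod_subgroup)
  fix u x assume u: "u \<in> ideal_prod I J"
  have "ideal_prod I J \<subseteq> {u. u * x \<in> ideal_prod I J}"
    by (rule ideal_prod_subset)
       (use assms in \<open>auto intro!: add_subgroup_vimage_mult_right ideal_prod_subgroup ideal_prodI
         simp: right_ideal_def mult.assoc\<close>)
  with u show "u * x \<in> ideal_prod I J" by blast
qed

lemma left_ideal_power: "left_ideal J \<Longrightarrow> left_ideal (ideal_power J n)"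
  by (induction J n rule: ideal_power.induct)
     (auto intro: left_ideal_ideal_prod simp: left_ideal_def[of UNIV] add_subgroup_def)

lemma ideal_power_Suc_subset:
  assumes "right_ideal J"
  shows "ideal_power J (Suc n) \<subseteq> ideal_power J n"
proof -
  have r: "right_ideal (ideal_power J n)"
    \<comment> \<open>The split on \<open>n\<close> and \<open>n - 1\<close> matches the three
      equations of \<open>ideal_power\<close>.\<close>
    using assms by (cases n; cases "n - 1")
      (auto simp: right_ideal_def[of UNIV] add_subgroup_def intro: right_ideal_ideal_prod)
  show ?thesis
  proof (cases "n = 0")
    case False
    then show ?thesis
      using r by (simp add: ideal_power_Suc right_ideal_def ideal_prod_subset)
  qed simp
qed

lemma ideal_power_antimono:
  assumes "right_ideal J" "n \<le> m"
  shows "ideal_power J m \<subseteq> ideal_power J n"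
  using assms(2) by (induction rule: dec_induct) (use ideal_power_Suc_subset[OF assms(1)] in auto)

text \<open>For \<open>k = 0\<close> the factor \<open>x\<close> is arbitrary, and the left ideal
  property of \<open>J\<close> takes the place of the definition of the power.\<close>

lemma ideal_power_step:
  assumes "left_ideal J" "x \<in> ideal_power J k" "y \<in> J"
  shows "x * y \<in> ideal_power J (Suc k)"
  using assms by (cases k) (auto simp: left_ideal_def intro: ideal_prodI)

section \<open>Homogeneous components and graded right ideals\<close>

context graded_ring
begin

text \<open>Summation is a bijection from finitely supported homogeneous families onto the ring; its
  inverse yields the family of homogeneous components of \<open>x\<close>, which is 0 outside the
  arrows.\<close>

definition cmp :: "'r \<Rightarrow> 'g \<Rightarrow> 'r"
  where "cmp x = the_inv_into (fin_supp_families (arrows \<Gamma>) R) (\<lambda>f. \<Sum>i | f i \<noteq> 0. f i) x"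

abbreviation gri :: "'r set \<Rightarrow> bool"
  where "gri \<equiv> graded_right_ideal \<Gamma> R"

abbreviation principal :: "'g \<Rightarrow> 'r set"
  where "principal e \<equiv> {one e * x | x. True}"

abbreviation rad :: "'r set"
  where "rad \<equiv> gr_radical \<Gamma> R"

lemma R_subgroup: "\<gamma> \<in> arrows \<Gamma> \<Longrightarrow> add_subgroup (R \<gamma>)"
  using direct_sum by (simp add: internal_direct_sum_def)

lemma bij_sum: "bij_betw (\<lambda>f. \<Sum>i | f i \<noteq> 0. f i) (fin_supp_families (arrows \<Gamma>) R) UNIV"
  using direct_sum by (simp add: internal_direct_sum_def)

lemma cmp_fam: "cmp x \<in> fin_supp_families (arrows \<Gamma>) R"
  unfolding cmp_def using bij_sum by (auto simp: bij_betw_def intro: the_inv_into_into)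

lemma cmp_in: "\<gamma> \<in> arrows \<Gamma> \<Longrightarrow> cmp x \<gamma> \<in> R \<gamma>"
  and cmp_outside: "\<gamma> \<notin> arrows \<Gamma> \<Longrightarrow> cmp x \<gamma> = 0"
  and finite_cmp: "finite {\<gamma>. cmp x \<gamma> \<noteq> 0}"
  using cmp_fam[of x] by (auto simp: fin_supp_families_def)

lemma sum_cmp: "(\<Sum>\<gamma> | cmp x \<gamma> \<noteq> 0. cmp x \<gamma>) = x"
  unfolding cmp_def
  using f_the_inv_into_f_bij_betw[OF bij_sum] by simp

lemma cmp_unique:
  assumes "f \<in> fin_supp_families (arrows \<Gamma>) R" "(\<Sum>\<gamma> | f \<gamma> \<noteq> 0. f \<gamma>) = x"
  shows "cmp x = f"
  unfolding cmp_def using assms bij_sum by (auto simp: bij_betw_def intro: the_inv_into_f_eq)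

lemma cmp_add: "cmp (x + y) \<gamma> = cmp x \<gamma> + cmp y \<gamma>"
proof -
  let ?f = "\<lambda>\<gamma>. cmp x \<gamma> + cmp y \<gamma>"
  let ?S = "{\<gamma>. cmp x \<gamma> \<noteq> 0} \<union> {\<gamma>. cmp y \<gamma> \<noteq> 0}"
  have fin: "finite ?S" by (simp add: finite_cmp)
  have sub: "{\<gamma>. ?f \<gamma> \<noteq> 0} \<subseteq> ?S" by auto
  have "?f \<in> fin_supp_families (arrows \<Gamma>) R"
    unfolding fin_supp_families_def
    using finite_subset[OF sub fin] R_subgroup cmp_in cmp_outside by (auto intro: add_subgroup_add)
  moreover have "(\<Sum>\<gamma> | ?f \<gamma> \<noteq> 0. ?f \<gamma>) = (\<Sum>\<gamma>\<in>?S. ?f \<gamma>)"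
    by (rule sum.mono_neutral_left) (use fin sub in auto)
  moreover have "\<dots> = (\<Sum>\<gamma>\<in>?S. cmp x \<gamma>) + (\<Sum>\<gamma>\<in>?S. cmp y \<gamma>)"
    by (rule sum.distrib)
  moreover have "(\<Sum>\<gamma>\<in>?S. cmp x \<gamma>) = (\<Sum>\<gamma> | cmp x \<gamma> \<noteq> 0. cmp x \<gamma>)"
    by (rule sum.mono_neutral_right) (use fin in auto)
  moreover have "(\<Sum>\<gamma>\<in>?S. cmp y \<gamma>) = (\<Sum>\<gamma> | cmp y \<gamma> \<noteq> 0. cmp y \<gamma>)"
    by (rule sum.mono_neutral_right) (use fin in auto)
  ultimately have "cmp (x + y) = ?f"
    by (intro cmp_unique) (simp_all add: sum_cmp)
  then show ?thesis by simp
qed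

lemma cmp_0 [simp]: "cmp 0 \<gamma> = 0"
  using cmp_add[of 0 0] by simp

lemma cmp_sum: "cmp (sum f I) \<gamma> = (\<Sum>i\<in>I. cmp (f i) \<gamma>)"
  by (induction I rule: infinite_finite_induct) (auto simp: cmp_add)

lemma cmp_homogeneous:
  assumes "\<gamma> \<in> arrows \<Gamma>" "a \<in> R \<gamma>"
  shows "cmp a \<delta> = (if \<delta> = \<gamma> then a else 0)"
proof -
  let ?f = "\<lambda>\<delta>. if \<delta> = \<gamma> then a else 0"
  have sub: "{\<delta>. ?f \<delta> \<noteq> 0} \<subseteq> {\<gamma>}" by auto
  have "?f \<in> fin_supp_families (arrows \<Gamma>) R"
    unfolding fin_supp_families_def
    using assms R_subgroup finite_subset[OF sub] by (auto intro: add_subgroup_0)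
  moreover have "(\<Sum>\<delta> | ?f \<delta> \<noteq> 0. ?f \<delta>) = (\<Sum>\<delta>\<in>{\<gamma>}. ?f \<delta>)"
    by (rule sum.mono_neutral_left) auto
  ultimately have "cmp a = ?f"
    by (intro cmp_unique) auto
  then show ?thesis by simp
qed

text \<open>An element is the finite sum of its components. This reduces later membership claims to
  homogeneous elements.\<close>

lemma in_subgroup_cmp:
  assumes "add_subgroup U" "\<And>\<gamma>. \<gamma> \<in> arrows \<Gamma> \<Longrightarrow> cmp x \<gamma> \<in> U"
  shows "x \<in> U"
  using add_subgroup_sum[OF assms(1), of "{\<gamma>. cmp x \<gamma> \<noteq> 0}" "cmp x"] assms(2) cmp_outside
  by (auto simp: sum_cmp)

text \<open>Replaces the direct sum condition by closure under components. A decomposition of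
  \<open>u\<close> inside \<open>U\<close> is also one in the whole ring, so by uniqueness it is
  \<open>cmp u\<close>; conversely, injectivity of summation is inherited from the whole
  ring.\<close>

lemma gri_iff: "gri U \<longleftrightarrow> right_ideal U \<and> (\<forall>u\<in>U. \<forall>\<gamma>\<in>arrows \<Gamma>. cmp u \<gamma> \<in> U)"
proof safe
  assume U: "gri U"
  then show "right_ideal U" by (simp add: graded_right_ideal_def)
  fix u \<gamma> assume u: "u \<in> U" and \<gamma>: "\<gamma> \<in> arrows \<Gamma>"
  have "u \<in> (\<lambda>f. \<Sum>i | f i \<noteq> 0. f i) ` fin_supp_families (arrows \<Gamma>) (\<lambda>\<gamma>. U \<inter> R \<gamma>)"
    using U u by (auto simp: graded_right_ideal_def internal_direct_sum_def bij_betw_def)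
  then obtain f where f: "f \<in> fin_supp_families (arrows \<Gamma>) (\<lambda>\<gamma>. U \<inter> R \<gamma>)"
      and s: "(\<Sum>i | f i \<noteq> 0. f i) = u" by blast
  have "cmp u = f"
    by (rule cmp_unique) (use f s in \<open>auto simp: fin_supp_families_def\<close>)
  then show "cmp u \<gamma> \<in> U" using f \<gamma> by (auto simp: fin_supp_families_def)
next
  assume r: "right_ideal U" and c: "\<forall>u\<in>U. \<forall>\<gamma>\<in>arrows \<Gamma>. cmp u \<gamma> \<in> U"
  let ?F = "fin_supp_families (arrows \<Gamma>) (\<lambda>\<gamma>. U \<inter> R \<gamma>)"
  have sg: "add_subgroup U" using r by (simp add: right_ideal_def)
  have sub: "?F \<subseteq> fin_supp_families (arrows \<Gamma>) R" by (auto simp: fin_supp_families_def)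
  have inj: "inj_on (\<lambda>f. \<Sum>i | f i \<noteq> 0. f i) ?F"
    using bij_sum inj_on_subset[OF _ sub] by (auto simp: bij_betw_def)
  have img: "(\<lambda>f. \<Sum>i | f i \<noteq> 0. f i) ` ?F = U"
  proof safe
    fix f assume "f \<in> ?F"
    then show "(\<Sum>i | f i \<noteq> 0. f i) \<in> U"
      by (intro add_subgroup_sum[OF sg]) (auto simp: fin_supp_families_def)
  next
    fix u assume u: "u \<in> U"
    have "cmp u \<in> ?F"
      using c u cmp_in cmp_outside finite_cmp by (auto simp: fin_supp_families_def)
    then show "u \<in> (\<lambda>f. \<Sum>i | f i \<noteq> 0. f i) ` ?F"
      by (intro image_eqI[of _ _ "cmp u"]) (simp_all add: sum_cmp)
  qed
  show "gri U"
    unfolding graded_right_ideal_def internal_direct_sum_def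
    using r sg R_subgroup inj img by (auto simp: bij_betw_def intro: add_subgroup_Int)
qed

lemma gri_subgroup: "gri U \<Longrightarrow> add_subgroup U"
  and gri_mult: "gri U \<Longrightarrow> u \<in> U \<Longrightarrow> u * x \<in> U"
  and gri_cmp: "gri U \<Longrightarrow> u \<in> U \<Longrightarrow> \<gamma> \<in> arrows \<Gamma> \<Longrightarrow> cmp u \<gamma> \<in> U"
  by (auto simp: gri_iff right_ideal_def)

lemma gri_UNIV: "gri UNIV"
  by (auto simp: gri_iff right_ideal_def add_subgroup_def)

lemma gri_Inter: "(\<And>U. U \<in> \<U> \<Longrightarrow> gri U) \<Longrightarrow> gri (\<Inter>\<U>)"
  by (auto simp: gri_iff right_ideal_def add_subgroup_def)

lemma gri_Int: "gri U \<Longrightarrow> gri V \<Longrightarrow> gri (U \<inter> V)"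
  using gri_Inter[of "{U, V}"] by auto

lemma gri_plus:
  assumes "gri U" "gri V"
  shows "gri (U + V)"
  unfolding gri_iff right_ideal_def
proof (intro conjI ballI allI)
  show "add_subgroup (U + V)" using assms by (simp add: add_subgroup_plus gri_subgroup)
next
  fix w x assume "w \<in> U + V"
  then show "w * x \<in> U + V"
    by (elim set_plus_elim) (auto simp: distrib_right intro!: set_plus_intro gri_mult assms)
next
  fix w \<gamma> assume "w \<in> U + V" "\<gamma> \<in> arrows \<Gamma>"
  then show "cmp w \<gamma> \<in> U + V"
    by (elim set_plus_elim) (auto simp: cmp_add intro!: set_plus_intro gri_cmp assms)
qed

lemma gri_plus_left: "gri U \<Longrightarrow> gri V \<Longrightarrow> U \<subseteq> U + V"
  and gri_plus_right: "gri U \<Longrightarrow> gri V \<Longrightarrow> V \<subseteq> U + V"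
  using set_plus_intro[of _ U 0 V] set_plus_intro[of 0 U _ V] add_subgroup_0[OF gri_subgroup]
  by fastforce+

lemma gri_plus_least: "gri W \<Longrightarrow> U \<subseteq> W \<Longrightarrow> V \<subseteq> W \<Longrightarrow> U + V \<subseteq> W"
  by (auto elim!: set_plus_elim intro!: add_subgroup_add[OF gri_subgroup])

lemma gri_chain_Union:
  assumes "\<C> \<noteq> {}" "\<And>U. U \<in> \<C> \<Longrightarrow> gri U" "\<And>U V. U \<in> \<C> \<Longrightarrow> V \<in> \<C> \<Longrightarrow> U \<subseteq> V \<or> V \<subseteq> U"
  shows "gri (\<Union>\<C>)"
  unfolding gri_iff right_ideal_def add_subgroup_def
proof (intro conjI ballI allI)
  show "0 \<in> \<Union>\<C>" using assms(1,2) add_subgroup_0[OF gri_subgroup] by blast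
  fix x y assume "x \<in> \<Union>\<C>" "y \<in> \<Union>\<C>"
  then obtain U where "U \<in> \<C>" "x \<in> U" "y \<in> U" using assms(3) by blast
  then show "x + y \<in> \<Union>\<C>" using add_subgroup_add[OF gri_subgroup[OF assms(2)]] by blast
qed (use assms(2) add_subgroup_uminus[OF gri_subgroup] gri_mult gri_cmp in blast)+

text \<open>The condition \<open>M \<inter> S \<subseteq> T\<close> survives unions of chains. It
  covers both later uses: avoiding a local identity (\<open>S = {one e}\<close>,
  \<open>T = {}\<close>) and meeting a given ideal only inside a smaller one.\<close>

lemma gri_Zorn:
  assumes "gri K" "K \<inter> S \<subseteq> T"
  obtains M where "gri M" "K \<subseteq> M" "M \<inter> S \<subseteq> T"
    "\<And>V. gri V \<Longrightarrow> M \<subseteq> V \<Longrightarrow> V \<inter> S \<subseteq> T \<Longrightarrow> V = M"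
proof -
  let ?A = "{M. gri M \<and> K \<subseteq> M \<and> M \<inter> S \<subseteq> T}"
  have "\<exists>M\<in>?A. \<forall>X\<in>?A. M \<subseteq> X \<longrightarrow> X = M"
  proof (rule subset_Zorn_nonempty)
    show "?A \<noteq> {}" using assms by auto
    fix \<C> assume ne: "\<C> \<noteq> {}" and "subset.chain ?A \<C>"
    then have c: "\<C> \<subseteq> ?A" "\<And>U V. U \<in> \<C> \<Longrightarrow> V \<in> \<C> \<Longrightarrow> U \<subseteq> V \<or> V \<subseteq> U"
      by (auto simp: subset_chain_def)
    have "gri (\<Union>\<C>)" by (rule gri_chain_Union) (use ne c in auto)
    moreover have "K \<subseteq> \<Union>\<C>" using ne c(1) by blast
    moreover have "\<Union>\<C> \<inter> S \<subseteq> T" using c(1) by blast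
    ultimately show "\<Union>\<C> \<in> ?A" by simp
  qed
  then obtain M where "M \<in> ?A" "\<forall>X\<in>?A. M \<subseteq> X \<longrightarrow> X = M" ..
  then show ?thesis by (intro that[of M]) auto
qed

section \<open>Multiplication by homogeneous elements\<close>

lemma mult_homogeneous_cases:
  assumes "\<gamma> \<in> arrows \<Gamma>" "\<delta> \<in> arrows \<Gamma>" "a \<in> R \<gamma>" "b \<in> R \<delta>"
  obtains "gdom \<Gamma> \<gamma> = gcod \<Gamma> \<delta>" "gmul \<Gamma> \<gamma> \<delta> \<in> arrows \<Gamma>" "a * b \<in> R (gmul \<Gamma> \<gamma> \<delta>)"
  | "gdom \<Gamma> \<gamma> \<noteq> gcod \<Gamma> \<delta>" "a * b = 0"
  using assms mult_composable mult_not_composable mul_closed by metis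

lemma gmul_left_cancel:
  assumes "\<gamma> \<in> arrows \<Gamma>" "\<delta> \<in> arrows \<Gamma>" "\<eta> \<in> arrows \<Gamma>"
    and "gdom \<Gamma> \<gamma> = gcod \<Gamma> \<delta>" "gdom \<Gamma> \<gamma> = gcod \<Gamma> \<eta>" "gmul \<Gamma> \<gamma> \<delta> = gmul \<Gamma> \<gamma> \<eta>"
  shows "\<delta> = \<eta>"
  using assms by (metis cod_mul_self dom_eq dom_inv inv_closed mul_assoc)

lemma mult_eq_sum_cmp: "a * x = (\<Sum>\<delta> | cmp x \<delta> \<noteq> 0. a * cmp x \<delta>)"
  by (metis sum_cmp sum_distrib_left)

text \<open>Left cancellation in the groupoid keeps the degrees apart: among the products
  \<open>a * cmp x \<eta>\<close>, only the one with \<open>\<eta> = \<delta>\<close> can contribute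
  to degree \<open>\<gamma>\<delta>\<close>.\<close>

lemma cmp_mult:
  assumes "\<gamma> \<in> arrows \<Gamma>" "a \<in> R \<gamma>" "\<delta> \<in> arrows \<Gamma>" "gdom \<Gamma> \<gamma> = gcod \<Gamma> \<delta>"
  shows "cmp (a * x) (gmul \<Gamma> \<gamma> \<delta>) = a * cmp x \<delta>"
proof -
  have *: "cmp (a * cmp x \<eta>) (gmul \<Gamma> \<gamma> \<delta>) = (if \<eta> = \<delta> then a * cmp x \<eta> else 0)" for \<eta>
  proof (cases "\<eta> \<in> arrows \<Gamma>")
    case True
    show ?thesis
      by (rule mult_homogeneous_cases[OF assms(1) True assms(2) cmp_in[OF True, of x]])
         (use gmul_left_cancel[OF assms(1) True assms(3)] assms in \<open>auto simp: cmp_homogeneous\<close>)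
  qed (use assms(3) in \<open>auto simp: cmp_outside\<close>)
  have "cmp (a * x) (gmul \<Gamma> \<gamma> \<delta>) = (\<Sum>\<eta> | cmp x \<eta> \<noteq> 0. if \<eta> = \<delta> then a * cmp x \<eta> else 0)"
    by (subst mult_eq_sum_cmp) (simp add: cmp_sum *)
  also have "\<dots> = a * cmp x \<delta>"
    by (simp add: finite_cmp)
  finally show ?thesis .
qed

text \<open>A component of \<open>u\<close> either composes with \<open>a\<close>, and then its
  image is a component of \<open>a * u\<close>, or is annihilated by \<open>a\<close>.\<close>

lemma gri_vimage:
  assumes "\<gamma> \<in> arrows \<Gamma>" "a \<in> R \<gamma>" "gri L"
  shows "gri {x. a * x \<in> L}"
  unfolding gri_iff right_ideal_def
proof (intro conjI ballI allI add_subgroup_vimage_mult_left gri_subgroup assms)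
  fix u x assume "u \<in> {x. a * x \<in> L}"
  then show "u * x \<in> {x. a * x \<in> L}"
    using gri_mult[OF assms(3)] by (simp flip: mult.assoc)
next
  fix u \<delta> assume u: "u \<in> {x. a * x \<in> L}" and \<delta>: "\<delta> \<in> arrows \<Gamma>"
  show "cmp u \<delta> \<in> {x. a * x \<in> L}"
  proof (rule mult_homogeneous_cases[OF assms(1) \<delta> assms(2) cmp_in[OF \<delta>, of u]])
    assume "gdom \<Gamma> \<gamma> = gcod \<Gamma> \<delta>" "gmul \<Gamma> \<gamma> \<delta> \<in> arrows \<Gamma>"
    then show ?thesis using cmp_mult[OF assms(1,2) \<delta>] gri_cmp[OF assms(3), of "a * u"] u by force
  qed (simp add: add_subgroup_0[OF gri_subgroup[OF assms(3)]])
qed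

text \<open>A product of homogeneous elements is homogeneous or 0, so its only possible components
  are itself and 0.\<close>

lemma cmp_homogeneous_in:
  assumes "add_subgroup U" "\<gamma> \<in> arrows \<Gamma>" "a \<in> R \<gamma>" "\<delta> \<in> arrows \<Gamma>" "b \<in> R \<delta>" "a * b \<in> U"
  shows "cmp (a * b) \<eta> \<in> U"
  by (rule mult_homogeneous_cases[OF assms(2,4,3,5)])
     (use assms(6) add_subgroup_0[OF assms(1)] in \<open>auto simp: cmp_homogeneous\<close>)

lemma gri_image:
  assumes "\<gamma> \<in> arrows \<Gamma>" "a \<in> R \<gamma>" "gri K"
  shows "gri ((*) a ` K)"
proof -
  have sg: "add_subgroup ((*) a ` K)"
    unfolding add_subgroup_def
  proof (intro conjI ballI)
    show "0 \<in> (*) a ` K"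
      using add_subgroup_0[OF gri_subgroup[OF assms(3)]] by (rule rev_image_eqI) simp
  qed (use gri_subgroup[OF assms(3)] in
        \<open>auto simp: add_subgroup_def simp flip: distrib_left mult_minus_right\<close>)
  show ?thesis
    unfolding gri_iff right_ideal_def
  proof (intro conjI ballI allI sg)
    fix u x assume "u \<in> (*) a ` K"
    then show "u * x \<in> (*) a ` K" using gri_mult[OF assms(3)] by (auto simp: mult.assoc)
  next
    fix u \<delta> assume "u \<in> (*) a ` K" "\<delta> \<in> arrows \<Gamma>"
    then obtain x where x: "x \<in> K" "u = a * x" by auto
    show "cmp u \<delta> \<in> (*) a ` K"
      unfolding x(2) mult_eq_sum_cmp[of a x] cmp_sum
    proof (rule add_subgroup_sum[OF sg])
      fix \<eta> assume "\<eta> \<in> {\<eta>. cmp x \<eta> \<noteq> 0}"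
      then have \<eta>: "\<eta> \<in> arrows \<Gamma>" using cmp_outside by auto
      show "cmp (a * cmp x \<eta>) \<delta> \<in> (*) a ` K"
        by (rule cmp_homogeneous_in[OF sg assms(1,2) \<eta> cmp_in[OF \<eta>]])
           (use gri_cmp[OF assms(3) x(1) \<eta>] in auto)
    qed
  qed
qed

text \<open>Since both factors are graded, each generator \<open>a * b\<close> is a finite sum of
  products of components, and these products are themselves generators that are homogeneous or
  0.\<close>

lemma gri_ideal_prod:
  assumes "gri I" "gri J"
  shows "gri (ideal_prod I J)"
proof -
  let ?P = "ideal_prod I J"
  note sg = ideal_prod_subgroup[of I J]
  have "?P \<subseteq> {x. \<forall>\<delta>\<in>arrows \<Gamma>. cmp x \<delta> \<in> ?P}"
  proof (rule ideal_prod_subset)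
    have "cmp (- x) \<delta> = - cmp x \<delta>" for x \<delta>
      using cmp_add[of x "- x" \<delta>] by (simp add: eq_neg_iff_add_eq_0 add.commute)
    then show "add_subgroup {x. \<forall>\<delta>\<in>arrows \<Gamma>. cmp x \<delta> \<in> ?P}"
      using sg by (auto simp: add_subgroup_def cmp_add)
    fix a b assume a: "a \<in> I" and b: "b \<in> J"
    have ab: "a * b = (\<Sum>\<eta> | cmp b \<eta> \<noteq> 0. \<Sum>\<gamma> | cmp a \<gamma> \<noteq> 0. cmp a \<gamma> * cmp b \<eta>)"
      by (subst mult_eq_sum_cmp) (simp add: sum_cmp flip: sum_distrib_right)
    have "cmp (a * b) \<delta> \<in> ?P" for \<delta>
      unfolding ab cmp_sum
    proof (intro add_subgroup_sum[OF sg])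
      fix \<eta> \<gamma> assume "\<eta> \<in> {\<eta>. cmp b \<eta> \<noteq> 0}" "\<gamma> \<in> {\<gamma>. cmp a \<gamma> \<noteq> 0}"
      then have *: "\<eta> \<in> arrows \<Gamma>" "\<gamma> \<in> arrows \<Gamma>" using cmp_outside by auto
      show "cmp (cmp a \<gamma> * cmp b \<eta>) \<delta> \<in> ?P"
        by (rule cmp_homogeneous_in[OF sg *(2) cmp_in[OF *(2)] *(1) cmp_in[OF *(1)]])
           (intro ideal_prodI gri_cmp assms a b *)
    qed
    then show "a * b \<in> {x. \<forall>\<delta>\<in>arrows \<Gamma>. cmp x \<delta> \<in> ?P}" by simp
  qed
  moreover have "right_ideal ?P"
    using assms(2) by (intro right_ideal_ideal_prod) (simp add: gri_iff)
  ultimately show ?thesis by (auto simp: gri_iff)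
qed

lemma gri_ideal_power: "gri J \<Longrightarrow> gri (ideal_power J n)"
  by (induction J n rule: ideal_power.induct) (auto intro: gri_UNIV gri_ideal_prod)

section \<open>Objects and the right ideals generated by local identities\<close>

lemma identities_arrows: "e \<in> identities \<Gamma> \<Longrightarrow> e \<in> arrows \<Gamma>"
  by (auto simp: identities_def dom_closed)

lemma identity_dom: "e \<in> identities \<Gamma> \<Longrightarrow> gdom \<Gamma> e = e"
  and identity_cod: "e \<in> identities \<Gamma> \<Longrightarrow> gcod \<Gamma> e = e"
  by (auto simp: identities_def dom_dom cod_dom)

lemma dom_identity: "\<gamma> \<in> arrows \<Gamma> \<Longrightarrow> gdom \<Gamma> \<gamma> \<in> identities \<Gamma>"
  by (auto simp: identities_def)

lemma cod_identity: "\<gamma> \<in> arrows \<Gamma> \<Longrightarrow> gcod \<Gamma> \<gamma> \<in> identities \<Gamma>"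
  unfolding identities_def by (metis cod_closed dom_cod imageI)

lemma one_idem: "e \<in> identities \<Gamma> \<Longrightarrow> one e * one e = one e"
  using one_left[OF identities_arrows one_closed] by (simp add: identity_cod)

lemma principal_iff: "e \<in> identities \<Gamma> \<Longrightarrow> x \<in> principal e \<longleftrightarrow> one e * x = x"
  by (auto simp: one_idem simp flip: mult.assoc) metis

lemma gri_principal: "e \<in> identities \<Gamma> \<Longrightarrow> gri (principal e)"
  using gri_image[OF identities_arrows one_closed gri_UNIV] by (simp add: full_SetCompr_eq)

section \<open>The graded radical\<close>

lemma gr_max_gri: "gr_maximal_right_ideal \<Gamma> R M \<Longrightarrow> gri M"
  by (simp add: gr_maximal_right_ideal_def)

lemma gr_max_plus:
  assumes "gr_maximal_right_ideal \<Gamma> R M" "gri V" "\<not> V \<subseteq> M"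
  shows "V + M = UNIV"
  using assms gri_plus gri_plus_left gri_plus_right
  unfolding gr_maximal_right_ideal_def by metis

lemma gri_rad: "gri rad"
  unfolding gr_radical_def by (rule gri_Inter) (simp add: gr_max_gri)

text \<open>The preimage of a gr-maximal right ideal under left multiplication by a homogeneous
  element is gr-maximal or the whole ring.\<close>
lemma left_ideal_rad: "left_ideal rad"
proof -
  have hom: "a * u \<in> rad" if \<gamma>: "\<gamma> \<in> arrows \<Gamma>" "a \<in> R \<gamma>" and u: "u \<in> rad" for \<gamma> a u
    unfolding gr_radical_def
  proof safe
    fix M assume M: "gr_maximal_right_ideal \<Gamma> R M"
    note gM = gr_max_gri[OF M]
    let ?N = "{x. a * x \<in> M}"
    have gN: "gri ?N" by (rule gri_vimage[OF \<gamma> gM])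
    have "gr_maximal_right_ideal \<Gamma> R ?N" if "?N \<noteq> UNIV"
      unfolding gr_maximal_right_ideal_def
    proof (intro conjI allI impI gN that, elim conjE)
      fix V assume V: "gri V" "V \<noteq> UNIV" "?N \<subseteq> V"
      have "V \<subseteq> ?N"
      proof (rule ccontr)
        assume "\<not> V \<subseteq> ?N"
        then have full: "(*) a ` V + M = UNIV"
          by (intro gr_max_plus[OF M gri_image[OF \<gamma> V(1)]]) auto
        have "x \<in> V" for x
        proof -
          have "a * x \<in> (*) a ` V + M" using full by simp
          then obtain v m where v: "v \<in> V" "m \<in> M" "a * x = a * v + m"
            by (auto elim!: set_plus_elim)
          \<comment> \<open>Here \<open>a * (x - v) = m\<close> lies in \<open>M\<close>, so
            \<open>x - v\<close> is in the preimage \<open>?N\<close> and hence in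
            \<open>V\<close>.\<close>
          then have "x - v \<in> V" using V(3) by (auto simp: right_diff_distrib)
          then show "x \<in> V" using add_subgroup_add[OF gri_subgroup[OF V(1)] _ v(1)] by fastforce
        qed
        with V(2) show False by auto
      qed
      with V(3) show "V = ?N" by auto
    qed
    then show "a * u \<in> M" using u by (auto simp: gr_radical_def)
  qed
  have "x * u \<in> rad" if "u \<in> rad" for x u
    using in_subgroup_cmp[OF add_subgroup_vimage_mult_right[OF gri_subgroup[OF gri_rad]], of x u]
      hom[OF _ cmp_in that] by simp
  then show ?thesis by (simp add: left_ideal_def gri_subgroup gri_rad)
qed

text \<open>A graded right ideal that contains \<open>K\<close> and \<open>one e\<close> is
  everything, because \<open>x - one e * x\<close> is annihilated by \<open>one e\<close> and so
  lies in \<open>K\<close>. Hence an ideal above \<open>K\<close> that is maximal for avoiding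
  \<open>one e\<close>, as supplied by Zorn's lemma, is gr-maximal.\<close>

lemma gr_max_exists:
  assumes e: "e \<in> identities \<Gamma>" and K: "gri K" "one e \<notin> K" "{x. one e * x = 0} \<subseteq> K"
  obtains M where "gr_maximal_right_ideal \<Gamma> R M" "K \<subseteq> M" "one e \<notin> M"
proof -
  obtain M where M: "gri M" "K \<subseteq> M" "M \<inter> {one e} \<subseteq> {}"
      "\<And>V. gri V \<Longrightarrow> M \<subseteq> V \<Longrightarrow> V \<inter> {one e} \<subseteq> {} \<Longrightarrow> V = M"
    by (rule gri_Zorn[of K "{one e}" "{}"]) (use K in auto)
  have "V = M" if V: "gri V" "V \<noteq> UNIV" "M \<subseteq> V" for V
  proof (rule M(4))
    have "one e \<notin> V"
    proof
      assume oV: "one e \<in> V"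
      have "x \<in> V" for x
      proof -
        have "one e * (x - one e * x) = 0"
          by (simp add: right_diff_distrib one_idem[OF e] flip: mult.assoc)
        then have "x - one e * x \<in> V" using K(3) M(2) V(3) by blast
        from add_subgroup_add[OF gri_subgroup[OF V(1)] this gri_mult[OF V(1) oV, of x]]
        show "x \<in> V" by simp
      qed
      with V(2) show False by auto
    qed
    then show "V \<inter> {one e} \<subseteq> {}" by simp
  qed (use V in auto)
  moreover have "M \<noteq> UNIV" using M(3) by auto
  ultimately have "gr_maximal_right_ideal \<Gamma> R M"
    using M(1) by (auto simp: gr_maximal_right_ideal_def)
  then show ?thesis using that M(2,3) by simp
qed

text \<open>If \<open>one e - y\<close> had no right inverse relative to \<open>one e\<close>, some
  gr-maximal right ideal avoiding \<open>one e\<close> would contain \<open>one e - y\<close>; it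
  also contains \<open>y\<close>, hence their sum \<open>one e\<close>, a contradiction.\<close>

lemma rad_quasi_regular:
  assumes e: "e \<in> identities \<Gamma>" and y: "y \<in> rad" "y \<in> R e"
  obtains z where "(one e - y) * z = one e"
proof -
  note ea = identities_arrows[OF e]
  have a: "one e - y \<in> R e"
    by (rule add_subgroup_diff[OF R_subgroup[OF ea] one_closed[OF e] y(2)])
  let ?L = "range ((*) (one e - y))"
  \<comment> \<open>Taking the preimage enlarges \<open>?L\<close> by the elements annihilated by
    \<open>one e\<close>, as \<open>gr_max_exists\<close> requires.\<close>
  let ?K = "{x. one e * x \<in> ?L}"
  have gL: "gri ?L" by (rule gri_image[OF ea a gri_UNIV])
  have gK: "gri ?K" by (rule gri_vimage[OF ea one_closed[OF e] gL])
  have "one e \<in> ?K"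
  proof (rule ccontr)
    assume "one e \<notin> ?K"
    then obtain M where M: "gr_maximal_right_ideal \<Gamma> R M" "?K \<subseteq> M" "one e \<notin> M"
      using add_subgroup_0[OF gri_subgroup[OF gL]] gr_max_exists[OF e gK] by force
    have "one e * (one e - y) = (one e - y) * one e"
      using one_left[OF ea a] one_right[OF ea a] e by (simp add: identity_cod identity_dom)
    then have "one e - y \<in> M" using M(2) by auto
    moreover have "y \<in> M" using y(1) M(1) by (auto simp: gr_radical_def)
    ultimately have "one e - y + y \<in> M"
      by (intro add_subgroup_add[OF gri_subgroup[OF gr_max_gri[OF M(1)]]])
    then show False using M(3) by simp
  qed
  then show ?thesis using that one_idem[OF e] by auto metis
qed

text \<open>A graded form of Nakayama's lemma. Comparing components of degree
  \<open>\<gamma>\<close> replaces \<open>y\<close> by its component at the object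
  \<open>d(\<gamma>)\<close>; then \<open>x\<close> is annihilated by the right invertible element
  of \<open>rad_quasi_regular\<close>.\<close>

lemma eq_0_if_fixed_by_rad:
  assumes \<gamma>: "\<gamma> \<in> arrows \<Gamma>" "x \<in> R \<gamma>" and y: "y \<in> rad" and eq: "x * y = x"
  shows "x = 0"
proof -
  let ?e = "gdom \<Gamma> \<gamma>"
  have e: "?e \<in> identities \<Gamma>" by (rule dom_identity[OF \<gamma>(1)])
  note ea = identities_arrows[OF e]
  have "x * cmp y ?e = cmp (x * y) (gmul \<Gamma> \<gamma> ?e)"
    by (rule cmp_mult[symmetric]) (use \<gamma> ea cod_dom in auto)
  also have "\<dots> = x"
    using \<gamma> by (simp add: eq mul_dom cmp_homogeneous)
  finally have x: "x * cmp y ?e = x" .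
  obtain z where z: "(one ?e - cmp y ?e) * z = one ?e"
    using rad_quasi_regular[OF e gri_cmp[OF gri_rad y ea] cmp_in[OF ea]] by blast
  have "x = x * ((one ?e - cmp y ?e) * z)"
    using one_right[OF \<gamma>] z by simp
  also have "\<dots> = (x * one ?e - x * cmp y ?e) * z"
    by (simp add: right_diff_distrib flip: mult.assoc)
  also have "\<dots> = 0" using one_right[OF \<gamma>] x by simp
  finally show ?thesis .
qed

end

section \<open>The artinian condition\<close>

locale artinian_graded_ring = graded_ring +
  assumes artinian: "right_artinian_at_objects \<Gamma> R one"
begin

text \<open>Without a minimal member, dependent choice would produce an infinite strictly descending
  chain.\<close>

lemma gri_minimal:
  assumes e: "e \<in> identities \<Gamma>" and ne: "P K" and P: "\<And>K. P K \<Longrightarrow> gri K \<and> K \<subseteq> principal e"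
  obtains M where "P M" "\<And>V. P V \<Longrightarrow> V \<subseteq> M \<Longrightarrow> V = M"
proof -
  have "\<exists>M. P M \<and> (\<forall>V. P V \<longrightarrow> V \<subseteq> M \<longrightarrow> V = M)"
  proof (rule ccontr)
    assume "\<not> ?thesis"
    then have "\<And>M n. P M \<Longrightarrow> \<exists>V. P V \<and> V \<subset> M" by blast
    then have "\<exists>U. \<forall>n. P (U n) \<and> U (Suc n) \<subset> U n"
      using dependent_nat_choice[of "\<lambda>_. P" "\<lambda>_ M V. V \<subset> M"] ne by blast
    then show False using artinian e P unfolding right_artinian_at_objects_def by meson
  qed
  then show ?thesis using that by blast
qed

section \<open>Supplements and complements modulo the radical\<close>

text \<open>Take a minimal supplement \<open>K\<close>. If a gr-maximal \<open>M\<close> did not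
  contain \<open>L \<inter> K\<close>, then \<open>(L \<inter> K) + M\<close> would be the whole
  ring, and by the modular law \<open>K \<inter> M\<close> would be a supplement too; minimality
  then forces \<open>K \<subseteq> M\<close>.\<close>

lemma supplement_mod_rad:
  assumes e: "e \<in> identities \<Gamma>" and L: "gri L" "L \<subseteq> principal e"
  obtains K where "gri K" "K \<subseteq> principal e" "L + K = principal e" "L \<inter> K \<subseteq> rad"
proof -
  let ?P = "\<lambda>K. gri K \<and> K \<subseteq> principal e \<and> L + K = principal e"
  note gP = gri_principal[OF e]
  have "?P (principal e)"
    using gP L gri_plus_right[OF L(1) gP] gri_plus_least[OF gP L(2) order_refl] by blast
  then obtain K where K: "?P K" and min: "\<And>V. ?P V \<Longrightarrow> V \<subseteq> K \<Longrightarrow> V = K"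
    by (rule gri_minimal[OF e, of ?P]) auto
  have "L \<inter> K \<subseteq> M" if M: "gr_maximal_right_ideal \<Gamma> R M" for M
  proof (rule ccontr)
    assume n: "\<not> L \<inter> K \<subseteq> M"
    note gM = gr_max_gri[OF M]
    have full: "(L \<inter> K) + M = UNIV" by (rule gr_max_plus[OF M gri_Int n]) (use L K in auto)
    have gKM: "gri (K \<inter> M)" using K gM by (auto intro: gri_Int)
    have "K \<subseteq> L + (K \<inter> M)"
    proof
      fix k assume k: "k \<in> K"
      have "k \<in> (L \<inter> K) + M" using full by simp
      then obtain l m where lm: "l \<in> L" "l \<in> K" "m \<in> M" "k = l + m"
        by (auto elim!: set_plus_elim)
      moreover have "m \<in> K"
        using add_subgroup_diff[OF gri_subgroup[of K] k lm(2)] K lm(4) by simp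
      ultimately show "k \<in> L + (K \<inter> M)" by (auto intro: set_plus_intro)
    qed
    then have "L + K \<subseteq> L + (K \<inter> M)"
      using gri_plus_least[OF gri_plus[OF L(1) gKM]] gri_plus_left[OF L(1) gKM] by blast
    moreover have "L + (K \<inter> M) \<subseteq> principal e"
      using gri_plus_least[OF gP L(2), of "K \<inter> M"] K by blast
    ultimately have "?P (K \<inter> M)" using K gKM by blast
    then have "K \<inter> M = K" by (rule min) simp
    with n show False by blast
  qed
  then have "L \<inter> K \<subseteq> rad" by (auto simp: gr_radical_def)
  then show ?thesis using that K by blast
qed

text \<open>Semisimplicity of \<open>A / B\<close>, which the radical annihilates. As in module
  theory, a \<open>K\<close> maximal with \<open>K \<inter> L \<subseteq> B\<close> is shown to
  satisfy \<open>A \<subseteq> L + K\<close>.\<close>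

lemma complement_mod_rad:
  assumes A: "gri A" and B: "gri B" and L: "gri L" and BL: "B \<subseteq> L" "L \<subseteq> A"
    and AB: "\<And>x y. x \<in> A \<Longrightarrow> y \<in> rad \<Longrightarrow> x * y \<in> B"
  obtains W where "gri W" "B \<subseteq> W" "W \<subseteq> A" "L \<inter> W = B" "L + W = A"
proof -
  obtain K where K: "gri K" "B \<subseteq> K" "K \<inter> L \<subseteq> B"
      and max: "\<And>V. gri V \<Longrightarrow> K \<subseteq> V \<Longrightarrow> V \<inter> L \<subseteq> B \<Longrightarrow> V = K"
    by (rule gri_Zorn[OF B, of L B]) auto
  have gLK: "gri (L + K)" by (rule gri_plus[OF L K(1)])
  have hom: "x \<in> L + K" if x: "x \<in> A" "x \<in> R \<gamma>" and \<gamma>: "\<gamma> \<in> arrows \<Gamma>" for x \<gamma>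
  proof -
    let ?f = "gdom \<Gamma> \<gamma>"
    have f: "?f \<in> identities \<Gamma>" by (rule dom_identity[OF \<gamma>])
    \<comment> \<open>Since \<open>x = x * one ?f\<close>, it suffices to split
      \<open>one ?f\<close> into a part that \<open>x\<close> sends into \<open>L + K\<close> and a
      part in a supplement \<open>S\<close>, where supplements are already available.\<close>
    let ?T = "{r. x * r \<in> L + K} \<inter> principal ?f"
    have gT: "gri ?T" by (rule gri_Int[OF gri_vimage[OF \<gamma> x(2) gLK] gri_principal[OF f]])
    obtain S where S: "gri S" "?T + S = principal ?f" "S \<subseteq> principal ?f" "?T \<inter> S \<subseteq> rad"
      by (rule supplement_mod_rad[OF f gT]) auto
    have gx: "gri ((*) x ` S)" by (rule gri_image[OF \<gamma> x(2) S(1)])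
    \<comment> \<open>If \<open>k + x * s\<close> lies in \<open>L\<close>, then
      \<open>x * s\<close> lies in \<open>L + K\<close>, so \<open>s\<close> is in
      \<open>?T \<inter> S\<close> and thus in the radical, and \<open>x * s\<close> falls into
      \<open>B\<close>. Hence the enlarged ideal still meets \<open>L\<close> inside
      \<open>B\<close>, and maximality of \<open>K\<close> applies.\<close>
    have "K + (*) x ` S = K"
    proof (rule max[OF gri_plus[OF K(1) gx] gri_plus_left[OF K(1) gx]])
      show "(K + (*) x ` S) \<inter> L \<subseteq> B"
      proof
        fix l assume "l \<in> (K + (*) x ` S) \<inter> L"
        then obtain k s where l: "l \<in> L" and k: "k \<in> K" and s: "s \<in> S" and eq: "l = k + x * s"
          by (auto elim!: set_plus_elim)
        have "x * s = l + - k" using eq by simp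
        then have "x * s \<in> L + K"
          using set_plus_intro[OF l add_subgroup_uminus[OF gri_subgroup[OF K(1)] k]] by simp
        then have "s \<in> ?T \<inter> S" using s S(3) by blast
        then have "x * s \<in> B" using S(4) AB x(1) by blast
        then have "l \<in> K" using add_subgroup_add[OF gri_subgroup[OF K(1)] k] K(2) eq by blast
        then show "l \<in> B" using K(3) l by blast
      qed
    qed
    then have xS: "(*) x ` S \<subseteq> K" using gri_plus_right[OF K(1) gx] by simp
    have "one ?f \<in> ?T + S" unfolding S(2) using one_idem[OF f] by (metis (mono_tags, lifting) CollectI)
    then obtain t s where "t \<in> ?T" "s \<in> S" "one ?f = t + s" by (rule set_plus_elim)
    moreover then have "x = x * t + x * s"
      using one_right[OF \<gamma> x(2)] by (metis distrib_left)
    moreover have "x * s \<in> L + K" using xS \<open>s \<in> S\<close> gri_plus_right[OF L K(1)] by blast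
    ultimately show ?thesis
      using add_subgroup_add[OF gri_subgroup[OF gLK]] by (metis (no_types, lifting) IntD1 mem_Collect_eq)
  qed
  have ALK: "A \<subseteq> L + K"
  proof
    fix x assume x: "x \<in> A"
    show "x \<in> L + K"
      by (rule in_subgroup_cmp[OF gri_subgroup[OF gLK]]) (blast intro: hom gri_cmp[OF A x] cmp_in)
  qed
  have gW: "gri (K \<inter> A)" by (rule gri_Int[OF K(1) A])
  have "A \<subseteq> L + (K \<inter> A)"
  proof
    fix x assume x: "x \<in> A"
    with ALK obtain l k where lk: "l \<in> L" "k \<in> K" "x = l + k" by (blast elim: set_plus_elim)
    then have "k \<in> A" using add_subgroup_diff[OF gri_subgroup[OF A] x, of l] BL(2) by auto
    then show "x \<in> L + (K \<inter> A)" using lk by auto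
  qed
  moreover have "L + (K \<inter> A) \<subseteq> A" by (rule gri_plus_least[OF A BL(2)]) simp
  ultimately have "L + (K \<inter> A) = A" by blast
  moreover have "L \<inter> (K \<inter> A) = B" using K BL by blast
  ultimately show ?thesis using that[OF gW] K(2) BL by blast
qed

text \<open>Choose \<open>W\<close> minimal among the complements of all the \<open>U n\<close>, say
  for \<open>U m\<close>. For \<open>n \<ge> m\<close>, a complement \<open>V\<close> of
  \<open>U n \<inter> W\<close> inside \<open>W\<close> is a complement of \<open>U n\<close> in
  \<open>A\<close>, so \<open>V = W\<close> and \<open>U n \<inter> W = B\<close>. The modular law
  then gives \<open>U n = U m\<close>.\<close>

lemma ascending_stable_mod_rad:
  assumes e: "e \<in> identities \<Gamma>" and A: "gri A" "A \<subseteq> principal e" and B: "gri B"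
    and AB: "\<And>x y. x \<in> A \<Longrightarrow> y \<in> rad \<Longrightarrow> x * y \<in> B"
    and U: "\<And>n::nat. gri (U n)" "\<And>n. B \<subseteq> U n" "\<And>n. U n \<subseteq> A" and mono: "\<And>m n. m \<le> n \<Longrightarrow> U m \<subseteq> U n"
  obtains m where "\<And>n. m \<le> n \<Longrightarrow> U n = U m"
proof -
  let ?C = "\<lambda>n W. gri W \<and> B \<subseteq> W \<and> W \<subseteq> A \<and> U n \<inter> W = B \<and> U n + W = A"
  let ?P = "\<lambda>W. \<exists>n. ?C n W"
  obtain W0 where "?C 0 W0"
    using complement_mod_rad[OF A(1) B U(1)[of 0] U(2) U(3) AB] by blast
  then have "?P W0" by blast
  then obtain W where "?P W" and min: "\<And>V. ?P V \<Longrightarrow> V \<subseteq> W \<Longrightarrow> V = W"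
    by (rule gri_minimal[OF e, of ?P]) (use A(2) in auto)
  then obtain m where W: "?C m W" by blast
  have "U n = U m" if mn: "m \<le> n" for n
  proof -
    obtain V where V: "gri V" "B \<subseteq> V" "V \<subseteq> W" "(U n \<inter> W) \<inter> V = B" "(U n \<inter> W) + V = W"
    proof (rule complement_mod_rad[of W B "U n \<inter> W"])
      show "gri (U n \<inter> W)" using W U(1) by (blast intro: gri_Int)
    qed (use W B U(2) AB in auto)
    have gUV: "gri (U n + V)" by (rule gri_plus[OF U(1) V(1)])
    have "U n \<subseteq> U n + V" "V \<subseteq> U n + V"
      by (rule gri_plus_left gri_plus_right, rule U, rule V)+
    then have "W \<subseteq> U n + V"
      using V(5) gri_plus_least[OF gUV, of "U n \<inter> W" V] by blast
    moreover have "U m \<subseteq> U n + V" using mono[OF mn] \<open>U n \<subseteq> U n + V\<close> by blast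
    ultimately have "A \<subseteq> U n + V" using W gri_plus_least[OF gUV, of "U m" W] by blast
    moreover have "U n + V \<subseteq> A" by (rule gri_plus_least[OF A(1)]) (use U(3) V W in auto)
    ultimately have "?C n V" using V W by blast
    then have "V = W" using min V(3) by blast
    then have UW: "U n \<inter> W = B" using V(4) by blast
    have "U n \<subseteq> U m"
    proof
      fix u assume u: "u \<in> U n"
      then have "u \<in> U m + W" using U(3) W by blast
      then obtain a w where aw: "a \<in> U m" "w \<in> W" "u = a + w" by (rule set_plus_elim)
      then have "w \<in> U n"
        using add_subgroup_diff[OF gri_subgroup[OF U(1)] u, of a] mono[OF mn] by auto
      then have "w \<in> U m" using UW aw(2) U(2) by blast
      then show "u \<in> U m" using add_subgroup_add[OF gri_subgroup[OF U(1)] aw(1)] aw(3) by blast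
    qed
    then show ?thesis using mono[OF mn] by blast
  qed
  then show ?thesis using that by blast
qed

section \<open>Nilpotence of the radical\<close>

lemma idempotent_in_rad_eq_0:
  assumes I: "gri I" "I \<subseteq> rad" "I \<subseteq> ideal_prod I I"
  shows "I = {0}"
proof (rule ccontr)
  assume "I \<noteq> {0}"
  then obtain u where u: "u \<in> I" "u \<noteq> 0" using add_subgroup_0[OF gri_subgroup[OF I(1)]] by blast
  \<comment> \<open>Contrapositively, if \<open>x * z\<close> is nonzero for some \<open>z\<close>
    in \<open>I\<close>, then \<open>x I I\<close> is nonzero. This makes \<open>x I\<close> again a
    competitor in the minimality argument.\<close>
  have vanish: "x * z = 0" if "\<And>a b. a \<in> I \<Longrightarrow> b \<in> I \<Longrightarrow> x * a * b = 0" "z \<in> I" for x z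
  proof -
    have "ideal_prod I I \<subseteq> {z. x * z \<in> {0}}"
      by (rule ideal_prod_subset[OF add_subgroup_vimage_mult_left])
         (use that(1) in \<open>auto simp: add_subgroup_def mult.assoc\<close>)
    then show ?thesis using that(2) I(3) by blast
  qed
  have "\<exists>a\<in>I. \<exists>b\<in>I. a * b \<noteq> 0"
  proof (rule ccontr)
    assume "\<not> ?thesis"
    then have "ideal_prod I I \<subseteq> {0}"
      by (intro ideal_prod_subset) (auto simp: add_subgroup_def)
    then show False using u I(3) by blast
  qed
  then obtain a b where ab: "a \<in> I" "b \<in> I" "a * b \<noteq> 0" by blast
  have hom: "\<exists>\<gamma>\<in>arrows \<Gamma>. cmp x \<gamma> * y \<noteq> 0" if "x * y \<noteq> 0" for x y
    using that in_subgroup_cmp[OF add_subgroup_vimage_mult_right[of "{0}" y], of x]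
    by (auto simp: add_subgroup_def)
  obtain \<gamma> where \<gamma>: "\<gamma> \<in> arrows \<Gamma>" "cmp a \<gamma> * b \<noteq> 0" using hom[OF ab(3)] by blast
  \<comment> \<open>The object is chosen so that the component \<open>cmp a \<gamma>\<close>, which
    does not annihilate \<open>I\<close>, lies in \<open>1_e R\<close>; thus
    \<open>I \<inter> principal ?e\<close> is a first competitor.\<close>
  let ?e = "gcod \<Gamma> \<gamma>"
  have e: "?e \<in> identities \<Gamma>" by (rule cod_identity[OF \<gamma>(1)])
  let ?P = "\<lambda>K. gri K \<and> K \<subseteq> principal ?e \<and> (\<exists>x\<in>K. \<exists>y\<in>I. x * y \<noteq> 0)"
  have "cmp a \<gamma> \<in> principal ?e"
    unfolding principal_iff[OF e] by (rule one_left[OF \<gamma>(1) cmp_in[OF \<gamma>(1)]])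
  then have "?P (I \<inter> principal ?e)"
    using gri_Int[OF I(1) gri_principal[OF e]] gri_cmp[OF I(1) ab(1) \<gamma>(1)] \<gamma>(2) ab(2) by blast
  then obtain K where K: "?P K" and min: "\<And>V. ?P V \<Longrightarrow> V \<subseteq> K \<Longrightarrow> V = K"
    by (rule gri_minimal[OF e, of ?P]) auto
  then obtain x' y where x': "x' \<in> K" and y: "y \<in> I" "x' * y \<noteq> 0" by blast
  obtain \<delta> where \<delta>: "\<delta> \<in> arrows \<Gamma>" "cmp x' \<delta> * y \<noteq> 0" using hom[OF y(2)] by blast
  \<comment> \<open>A homogeneous component replaces \<open>x'\<close>, since both
    \<open>gri_image\<close> and \<open>eq_0_if_fixed_by_rad\<close> need homogeneous
    elements.\<close>
  define x where "x = cmp x' \<delta>"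
  have x: "x \<in> R \<delta>" "x \<in> K" "x * y \<noteq> 0"
    using \<delta> cmp_in gri_cmp[OF _ x'] K by (auto simp: x_def)
  have sub: "(*) x ` I \<subseteq> K" using gri_mult K x(2) by blast
  have "\<exists>a\<in>I. \<exists>b\<in>I. x * a * b \<noteq> 0" using vanish[of x y] y(1) x(3) by blast
  then have "?P ((*) x ` I)" using gri_image[OF \<delta>(1) x(1) I(1)] sub K by blast
  then have "(*) x ` I = K" using min sub by blast
  then obtain z where "z \<in> I" "x * z = x" using x(2) by auto
  then have "x = 0" using eq_0_if_fixed_by_rad[OF \<delta>(1) x(1)] I(2) by blast
  with x(3) show False by simp
qed

lemma descending_stable:
  assumes e: "e \<in> identities \<Gamma>" and U: "\<And>n::nat. gri (U n)" "\<And>n. U n \<subseteq> principal e"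
    and anti: "\<And>m n. m \<le> n \<Longrightarrow> U n \<subseteq> U m"
  shows "\<exists>m. \<forall>n\<ge>m. U n = U m"
proof -
  have "\<exists>n. U 0 = U n" by blast
  then obtain M where "\<exists>n. M = U n" and min: "\<And>V. \<exists>n. V = U n \<Longrightarrow> V \<subseteq> M \<Longrightarrow> V = M"
    by (rule gri_minimal[OF e, of "\<lambda>V. \<exists>n. V = U n"]) (use U in blast)+
  from this(1) obtain m where "M = U m" ..
  then have "U n = U m" if "m \<le> n" for n using min[of "U n"] anti[OF that] by auto
  then show ?thesis by blast
qed

lemma rad_nilpotent:
  assumes "d_finitely_generated \<Gamma> one"
  obtains n where "n > 0" "ideal_power rad n = {0}"
proof -
  obtain D where D: "finite D" "D \<subseteq> identities \<Gamma>"
      "UNIV = {\<Sum>e\<in>D. f e | f. \<forall>e\<in>D. f e \<in> add_subgroup hull {a * one e * b | a b. True}}"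
    using assms unfolding d_finitely_generated_def by blast
  \<comment> \<open>As the powers are left ideals, this intersection is \<open>1_e J^n\<close> for
    \<open>J = rad\<close>; written this way, it is visibly a graded right ideal.\<close>
  let ?A = "\<lambda>e n. ideal_power rad n \<inter> principal e"
  have rrad: "right_ideal rad" using gri_rad by (simp add: gri_iff)
  have "\<exists>m. \<forall>n\<ge>m. ?A e n = ?A e m" if "e \<in> D" for e
  proof (rule descending_stable)
    show "e \<in> identities \<Gamma>" using that D by blast
    then show "gri (?A e n)" for n by (intro gri_Int gri_ideal_power gri_rad gri_principal)
    show "?A e n \<subseteq> ?A e m" if "m \<le> n" for m n using ideal_power_antimono[OF rrad that] by blast
  qed simp
  then have "\<forall>e\<in>D. \<exists>m. \<forall>n\<ge>m. ?A e n = ?A e m" ..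
  from bchoice[OF this] obtain m where m: "\<And>e n. e \<in> D \<Longrightarrow> n \<ge> m e \<Longrightarrow> ?A e n = ?A e (m e)"
    by blast
  \<comment> \<open>The sum bounds the finitely many stabilisation indices, and \<open>Suc\<close>
    makes the exponent positive.\<close>
  define N where "N = Suc (\<Sum>e\<in>D. m e)"
  have mN: "m e \<le> N" if "e \<in> D" for e
    using member_le_sum[of e D m] D(1) that by (simp add: N_def)
  let ?I = "ideal_power rad N"
  have gI: "gri ?I" by (rule gri_ideal_power[OF gri_rad])
  have lI: "left_ideal ?I" by (rule left_ideal_power[OF left_ideal_rad])
  have lII: "left_ideal (ideal_prod ?I ?I)" by (rule left_ideal_ideal_prod[OF lI])
  have N: "N > 0" by (simp add: N_def)
  \<comment> \<open>Both \<open>N\<close> and \<open>N + N\<close> are past the stabilisation index,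
    so \<open>1_e J^N = 1_e J^(2N)\<close>.\<close>
  have pII: "?I \<inter> principal e \<subseteq> ideal_prod ?I ?I" if "e \<in> D" for e
    using m[OF that mN[OF that]] m[OF that, of "N + N"] mN[OF that]
      ideal_power_add_subset[OF N N, of rad] by auto
  \<comment> \<open>Finite generation carries the inclusion from \<open>D\<close> to every object:
    the local identity fixing \<open>u\<close> is a sum of terms \<open>a * one e * b\<close> with
    \<open>e\<close> in \<open>D\<close>, and each \<open>one e * (b * u)\<close> is covered by
    \<open>pII\<close>.\<close>
  have sub: "u \<in> ideal_prod ?I ?I" if u: "u \<in> ?I" "u \<in> R \<gamma>" "\<gamma> \<in> arrows \<Gamma>" for u \<gamma>
  proof -
    let ?S = "{z. z * u \<in> ideal_prod ?I ?I}"
    have sg: "add_subgroup ?S"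
      by (rule add_subgroup_vimage_mult_right[OF ideal_prod_subgroup])
    have "one (gcod \<Gamma> \<gamma>) \<in> {\<Sum>e\<in>D. f e | f. \<forall>e\<in>D. f e \<in> add_subgroup hull {a * one e * b | a b. True}}"
      using D(3) by blast
    then obtain f where f: "one (gcod \<Gamma> \<gamma>) = (\<Sum>e\<in>D. f e)"
        "\<And>e. e \<in> D \<Longrightarrow> f e \<in> add_subgroup hull {a * one e * b | a b. True}" by auto
    have "f e \<in> ?S" if e: "e \<in> D" for e
    proof -
      have "{a * one e * b | a b. True} \<subseteq> ?S"
      proof clarify
        fix a b
        have "one e * (b * u) \<in> ?I \<inter> principal e" using lI u(1) by (auto simp: left_ideal_def)
        then have "a * (one e * (b * u)) \<in> ideal_prod ?I ?I"
          using pII[OF e] lII by (auto simp: left_ideal_def)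
        then show "a * one e * b * u \<in> ideal_prod ?I ?I" by (simp add: mult.assoc)
      qed
      then have "add_subgroup hull {a * one e * b | a b. True} \<subseteq> ?S" using sg by (rule hull_minimal)
      then show ?thesis using f(2)[OF e] by blast
    qed
    then have "one (gcod \<Gamma> \<gamma>) \<in> ?S" unfolding f(1) by (rule add_subgroup_sum[OF sg])
    then show ?thesis using one_left[OF u(3,2)] by simp
  qed
  have "?I \<subseteq> ideal_prod ?I ?I"
  proof
    fix u assume u: "u \<in> ?I"
    show "u \<in> ideal_prod ?I ?I"
      by (rule in_subgroup_cmp[OF ideal_prod_subgroup]) (blast intro: sub gri_cmp[OF gI u] cmp_in)
  qed
  moreover have "?I \<subseteq> rad" using ideal_power_antimono[OF rrad, of 1 N] N by simp
  ultimately have "?I = {0}" using idempotent_in_rad_eq_0[OF gI] by blast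
  then show ?thesis using that N by blast
qed

section \<open>The ascending chain condition\<close>

lemma noetherian_if_rad_nilpotent:
  assumes N: "ideal_power rad N = {0}"
  shows "right_noetherian_at_objects \<Gamma> R one"
  unfolding right_noetherian_at_objects_def
proof (intro ballI notI)
  fix e assume e: "e \<in> identities \<Gamma>"
  assume "\<exists>U. \<forall>n. gri (U n) \<and> U n \<subseteq> principal e \<and> U n \<subset> U (Suc n)"
  then obtain U where "\<forall>n. gri (U n) \<and> U n \<subseteq> principal e \<and> U n \<subset> U (Suc n)" ..
  then have U: "gri (U n)" "U n \<subseteq> principal e" "U n \<subset> U (Suc n)" for n by simp_all
  have mono: "U m \<subseteq> U n" if "m \<le> n" for m n
    using that by (induction rule: dec_induct) (use U(3) in blast)+
  let ?A = "\<lambda>k. ideal_power rad k \<inter> principal e"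
  have gA: "gri (?A k)" for k by (intro gri_Int gri_ideal_power gri_rad gri_principal e)
  have rrad: "right_ideal rad" using gri_rad by (simp add: gri_iff)
  \<comment> \<open>Modulo \<open>?A (Suc k)\<close>, these are the traces of the chain on the
    factor \<open>1_e J^k / 1_e J^(k+1)\<close>.\<close>
  have "\<exists>m. \<forall>n\<ge>m. (U n \<inter> ?A k) + ?A (Suc k) = (U m \<inter> ?A k) + ?A (Suc k)" for k
  proof (rule ascending_stable_mod_rad[of e "?A k" "?A (Suc k)" "\<lambda>n. (U n \<inter> ?A k) + ?A (Suc k)"])
    fix n
    have g: "gri (U n \<inter> ?A k)" by (rule gri_Int[OF U(1) gA])
    show "gri ((U n \<inter> ?A k) + ?A (Suc k))" by (rule gri_plus[OF g gA])
    show "?A (Suc k) \<subseteq> (U n \<inter> ?A k) + ?A (Suc k)" by (rule gri_plus_right[OF g gA])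
    show "(U n \<inter> ?A k) + ?A (Suc k) \<subseteq> ?A k"
      by (rule gri_plus_least[OF gA]) (use ideal_power_Suc_subset[OF rrad] in auto)
  next
    fix x y assume "x \<in> ?A k" "y \<in> rad"
    then show "x * y \<in> ?A (Suc k)"
      using ideal_power_step[OF left_ideal_rad, of x k y] gri_mult[OF gri_principal[OF e], of x y]
      by blast
  next
    fix m n :: nat assume "m \<le> n"
    then have "U m \<inter> ?A k \<subseteq> U n \<inter> ?A k" using mono by blast
    then show "(U m \<inter> ?A k) + ?A (Suc k) \<subseteq> (U n \<inter> ?A k) + ?A (Suc k)"
      by (rule set_plus_mono2) simp
  qed (use e gA in auto)
  then have "\<forall>k. \<exists>m. \<forall>n\<ge>m. (U n \<inter> ?A k) + ?A (Suc k) = (U m \<inter> ?A k) + ?A (Suc k)" ..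
  from choice[OF this] obtain m where m: "\<And>k n. n \<ge> m k \<Longrightarrow>
      (U n \<inter> ?A k) + ?A (Suc k) = (U (m k) \<inter> ?A k) + ?A (Suc k)" by blast
  define M where "M = (\<Sum>k<N. m k)"
  have mM: "m k \<le> M" if "k < N" for k
    using member_le_sum[of k "{..<N}" m] that by (simp add: M_def)
  \<comment> \<open>Downward induction from \<open>k = N\<close>, where the power is 0. An
    \<open>x\<close> in the larger ideal is corrected by some \<open>u\<close> in \<open>U M\<close>
    to an element of \<open>?A (Suc k)\<close>, to which the induction hypothesis applies.\<close>
  have "k \<le> N \<Longrightarrow> U (Suc M) \<inter> ?A k \<subseteq> U M" for k
  proof (induction k rule: inc_induct)
    case base
    then show ?case using N add_subgroup_0[OF gri_subgroup[OF U(1)]] by auto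
  next
    case (step k)
    note eq = m[of k M] m[of k "Suc M"] mM[OF step.hyps(2)]
    show ?case
    proof
      fix x assume x: "x \<in> U (Suc M) \<inter> ?A k"
      then have "x \<in> (U (Suc M) \<inter> ?A k) + ?A (Suc k)"
        using gri_plus_left[OF gri_Int[OF U(1) gA] gA] by blast
      then have "x \<in> (U M \<inter> ?A k) + ?A (Suc k)" using eq by simp
      then obtain u a where ua: "u \<in> U M \<inter> ?A k" "a \<in> ?A (Suc k)" "x = u + a"
        by (rule set_plus_elim)
      then have "a \<in> U (Suc M)"
        using add_subgroup_diff[OF gri_subgroup[OF U(1)], of x "Suc M" u] x mono[of M "Suc M"] by auto
      then have "a \<in> U M" using step.IH ua(2) by blast
      then show "x \<in> U M" using add_subgroup_add[OF gri_subgroup[OF U(1)], of u M a] ua by blast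
    qed
  qed
  \<comment> \<open>The convention at exponent 0 makes \<open>?A 0\<close> all of
    \<open>1_e R\<close>.\<close>
  moreover have "U (Suc M) \<inter> ?A 0 = U (Suc M)"
    using U(2)[of "Suc M"] by (simp only: ideal_power.simps Int_UNIV_left Int_absorb2)
  ultimately have "U (Suc M) \<subseteq> U M" by (metis le0)
  then show False using U(3) by blast
qed

end

theorem corollary8p11:
  fixes \<Gamma> :: "'g groupoid_data"
    and R :: "'g \<Rightarrow> 'r::ring set"
    and one :: "'g \<Rightarrow> 'r"
  assumes "graded_ring \<Gamma> R one"
    and "d_finitely_generated \<Gamma> one"
    and "right_artinian_at_objects \<Gamma> R one"
  shows "nilpotent_ideal (gr_radical \<Gamma> R) \<and> right_noetherian_at_objects \<Gamma> R one"
proof -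
  interpret artinian_graded_ring \<Gamma> R one
    using assms(1,3) by (simp add: artinian_graded_ring_def artinian_graded_ring_axioms_def)
  obtain n where "n > 0" "ideal_power rad n = {0}"
    using rad_nilpotent[OF assms(2)] by blast
  then show ?thesis
    using noetherian_if_rad_nilpotent by (auto simp: nilpotent_ideal_def)
qed

end
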